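(* Let $1<\upsilon<2$, $0<\mu<1$, $b\in\mathbb{N}$, $I=\{0,1,\dots,b+1\}$, let $\alpha\in\mathbb{R}$ with $|\alpha|<1$, and assume $e_{\upsilon-\mu,\upsilon}(\alpha,b+2)\ne0$. Let $f:[\upsilon-1,\upsilon+b]_{\mathbb{N}_{\upsilon-1}}\times\mathbb{R}\to\mathbb{R}$ be continuous, and assume: (A1) There exist a nondecreasing function $\psi:[0,\infty)\to[0,\infty)$ and a function $g:[\upsilon-2,\upsilon+b+1]_{\mathbb{N}_{\upsilon-2}}\to[0,\infty)$ such that $$|f(t+\upsilon-1,r)|\le g(t+\upsilon-1)\,\psi(|r|),\quad t\in I,\ r\in\mathbb{R}.$$ (A2) There exists $L>0$ such that $$\frac{L}{\psi(L)\displaystyle\max_{t\in[\upsilon-2,\upsilon+b+1]_{\mathbb{N}_{\upsilon-2}}}\sum_{s=\upsilon-1}^{\upsilon+b}g(s)\,|G(t,s)|}>1.$$ Then the boundary value problem $$-\Delta^{\upsilon}y(t)+\alpha\,\Delta^{\mu}y(t+\upsilon-\mu)=f(t+\upsilon-1,y(t+\upsilon-1)),\quad t\in I,$$ $$y(\upsilon-2)=y(\upsilon+b+1)=0,$$ has a solution $y$ defined on $[\upsilon-2,\upsilon+b+1]_{\mathbb{N}_{\upsilon-2}}$. Moreover, $y\not\equiv0$ on $[\upsilon-2,\upsilon+b+1]_{\mathbb{N}_{\upsilon-2}}$ when $f(t+\upsilon-1,0)\neq0$ for at least one $t\in I$.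
   Context: Notation: $\mathbb{N}=\{1,2,\dots\}$. For $a\in\mathbb{R}$, $\mathbb{N}_a=\{a,a+1,a+2,\dots\}$, and $[c,c+n]_{\mathbb{N}_c}=\{c,c+1,\dots,c+n\}$. Sums $\sum_{s=\upsilon-1}^{\upsilon+b}$ run over $s=\upsilon-1,\upsilon,\dots,\upsilon+b$. $\Delta$ is the forward difference, $\Delta f(t)=f(t+1)-f(t)$. Falling factorial: $t^{(\nu)}=\frac{\Gamma(t+1)}{\Gamma(t+1-\nu)}$ whenever the right-hand side is well defined, with $t^{(\nu)}=0$ if $t+1-\nu$ is a pole of $\Gamma$ and $t+1$ is not. Fractional sum: for $\nu>0$ and $f$ defined on $\mathbb{N}_a$, $\Delta^{-\nu}f(t)=\frac{1}{\Gamma(\nu)}\sum_{s=a}^{t-\nu}(t-s-1)^{(\nu-1)}f(s)$ (the sum running over $s=a,a+1,\dots,t-\nu$), for $t\in\mathbb{N}_{a+\nu}$. Riemann–Liouville fractional difference: $\Delta^{\nu}f(t)=\Delta^{N}\Delta^{\nu-N}f(t)$, with $N\in\mathbb{N}$, $N-1<\nu\le N$. In the equation, $\Delta^{\upsilon}y$ is taken with $y$ based at $a=\upsilon-2$, i.e. $\Delta^{\upsilon}y(t)=\Delta^2 S(t)$ with $S(\tau)=\frac{1}{\Gamma(2-\upsilon)}\sum_{s=\upsilon-2}^{\tau-2+\upsilon}(\tau-s-1)^{(1-\upsilon)}y(s)$. The term $\Delta^{\mu}y(t+\upsilon-\mu)$ means $(\Delta^{\mu}Y_1)(t)$, where $Y_1(t)=y(t+\upsilon-\mu)$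 is regarded as a function based at $a=\mu-1$, i.e. $\Delta^{\mu}y(t+\upsilon-\mu)=\Delta T(t)$ with $T(\tau)=\frac{1}{\Gamma(1-\mu)}\sum_{s=\mu-1}^{\tau-1+\mu}(\tau-s-1)^{(-\mu)}y(s+\upsilon-\mu)$. For $t\in I$ these expressions only involve values of $y$ on $[\upsilon-2,\upsilon+b+1]_{\mathbb{N}_{\upsilon-2}}$. Delta discrete Mittag-Leffler function: for $p>0$, $q\in\mathbb{R}$, $|\lambda|<1$ and an integer $n\ge -1$, $$e_{p,q}(\lambda,n)=\sum_{k=0}^{\infty}\lambda^k\frac{(n+kp+q-1)^{(kp+q-1)}}{\Gamma(kp+q)};$$ in particular, $e_{\upsilon-\mu,\upsilon}(\alpha,-1)=0$. Green's function: for $t\in[\upsilon-2,\upsilon+b+1]_{\mathbb{N}_{\upsilon-2}}$ and $s\in[\upsilon-1,\upsilon+b]_{\mathbb{N}_{\upsilon-1}}$, $$G(t,s)=\begin{cases}\dfrac{e_{\upsilon-\mu,\upsilon}(\alpha,t-\upsilon+1)}{e_{\upsilon-\mu,\upsilon}(\alpha,b+2)}\,e_{\upsilon-\mu,\upsilon}(\alpha,\upsilon+b-s)-e_{\upsilon-\mu,\upsilon}(\alpha,t-s-1), & s\le t,\\[2ex] \dfrac{e_{\upsilon-\mu,\upsilon}(\alpha,t-\upsilon+1)}{e_{\upsilon-\mu,\upsilon}(\alpha,b+2)}\,e_{\upsilon-\mu,\upsilon}(\alpha,\upsilon+b-s), & t+1\le s.\end{cases}$$ *)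

theory Defs
  imports "HOL-Analysis.Analysis"
begin

definition dset :: "real \<Rightarrow> real set" where
  "dset a = {a + real k | k. True}"

definition dint :: "real \<Rightarrow> real \<Rightarrow> real set" where
  "dint a c = {x \<in> dset a. x \<le> c}"

definition fdiff :: "(real \<Rightarrow> real) \<Rightarrow> real \<Rightarrow> real" where
  "fdiff f t = f (t + 1) - f t"

text \<open>If \<open>t + 1 - \<nu>\<close> is a pole of \<open>Gamma\<close>, then \<open>Gamma (t + 1 - \<nu>) = 0\<close> in the library, so the
  quotient is \<open>0\<close>, which is the usual convention for the falling factorial when \<open>t + 1\<close> is not a pole.\<close>

definition ffall :: "real \<Rightarrow> real \<Rightarrow> real" where
  "ffall t \<nu> = Gamma (t + 1) / Gamma (t + 1 - \<nu>)"

text \<open>The sum of order \<open>\<nu> \<ge> 0\<close> of a function based at \<open>a\<close>, meant for \<open>t \<in> dset (a + \<nu>)\<close>.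
  Order \<open>0\<close> is the identity, so that \<open>frac_diff\<close> is the ordinary difference for integer orders.\<close>

definition frac_sum :: "real \<Rightarrow> real \<Rightarrow> (real \<Rightarrow> real) \<Rightarrow> real \<Rightarrow> real" where
  "frac_sum \<nu> a f t =
     (if \<nu> = 0 then f t
      else 1 / Gamma \<nu> * (\<Sum>s\<in>dint a (t - \<nu>). ffall (t - s - 1) (\<nu> - 1) * f s))"

definition frac_diff :: "real \<Rightarrow> real \<Rightarrow> (real \<Rightarrow> real) \<Rightarrow> real \<Rightarrow> real" where
  "frac_diff \<nu> a f t =
     (let N = nat \<lceil>\<nu>\<rceil> in (fdiff ^^ N) (frac_sum (real N - \<nu>) a f) t)"

text \<open>The delta discrete Mittag-Leffler function, meant for \<open>p > 0\<close>, \<open>\<bar>l\<bar> < 1\<close> and an integer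
  \<open>n \<ge> -1\<close>; the argument \<open>n\<close> is a real number to allow differences of grid points.\<close>

definition dml :: "real \<Rightarrow> real \<Rightarrow> real \<Rightarrow> real \<Rightarrow> real" where
  "dml p q l n =
     (\<Sum>k. l ^ k * (ffall (n + real k * p + q - 1) (real k * p + q - 1) / Gamma (real k * p + q)))"

definition green :: "real \<Rightarrow> real \<Rightarrow> real \<Rightarrow> nat \<Rightarrow> real \<Rightarrow> real \<Rightarrow> real" where
  "green \<upsilon> \<mu> \<alpha> b t s =
     (let e = dml (\<upsilon> - \<mu>) \<upsilon> \<alpha> in
      if s \<le> t
      then e (t - \<upsilon> + 1) / e (real b + 2) * e (\<upsilon> + real b - s) - e (t - s - 1)
      else e (t - \<upsilon> + 1) / e (real b + 2) * e (\<upsilon> + real b - s))"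

text \<open>A solution is a function on the grid \<open>dint (\<upsilon> - 2) (\<upsilon> + b + 1)\<close>; its values elsewhere do not
  enter. The lower-order difference acts on the shifted function, based at \<open>\<mu> - 1\<close>.\<close>

definition bvp_solution ::
  "real \<Rightarrow> real \<Rightarrow> real \<Rightarrow> nat \<Rightarrow> (real \<Rightarrow> real \<Rightarrow> real) \<Rightarrow> (real \<Rightarrow> real) \<Rightarrow> bool" where
  "bvp_solution \<upsilon> \<mu> \<alpha> b f y \<longleftrightarrow>
     (\<forall>t\<in>dint 0 (real b + 1).
        - frac_diff \<upsilon> (\<upsilon> - 2) y t + \<alpha> * frac_diff \<mu> (\<mu> - 1) (\<lambda>x. y (x + \<upsilon> - \<mu>)) t
          = f (t + \<upsilon> - 1) (y (t + \<upsilon> - 1))) \<and>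
     y (\<upsilon> - 2) = 0 \<and> y (\<upsilon> + real b + 1) = 0"

end

theory Submission
  imports Defs "HOL-Computational_Algebra.Formal_Power_Series" "HOL-Real_Asymp.Real_Asymp"
begin

text \<open>
  On the grid \<open>\<upsilon> - 2, \<upsilon> - 1, \<dots>\<close> write \<open>u n = y (\<upsilon> - 2 + n)\<close> and \<open>U = (\<Sum>n. u n X^n)\<close>.
  A fractional sum of order \<open>\<nu>\<close> is a convolution with the coefficients of \<open>(1 - X)^(-\<nu>)\<close>, and a
  fractional difference a convolution with those of \<open>(1 - X)^\<nu>\<close> (\<open>frac_diff_eq_coeff\<close>). If
  \<open>u 0 = 0\<close>, the equation at \<open>t = m\<close> therefore says that the coefficient of \<open>X^(m + 2)\<close> in \<open>- D U\<close>
  is the right-hand side, where \<open>D = (1 - X)^\<upsilon> - \<alpha> (1 - X)^\<mu>\<close> (\<open>bvp_operator_eq_coeff\<close>). Expanding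
  \<open>1 / D\<close> as a geometric series in \<open>\<alpha> (1 - X)^(\<mu> - \<upsilon>)\<close> gives the series whose coefficients are the
  Mittag-Leffler values \<open>e(0), e(1), \<dots>\<close> (\<open>symbol_times_ml_series\<close>), so the equation together
  with \<open>u 0 = 0\<close> is equivalent to the discrete Volterra equation
  \<open>u n = \<beta> e(n - 1) - (\<Sum>m\<le>n - 2. e(n - 2 - m) f(\<upsilon> - 1 + m, u (m + 1)))\<close>
  with one free parameter \<open>\<beta>\<close>.

  The sum involves only \<open>u 1, \<dots>, u (n - 1)\<close>. Hence \<open>\<beta>\<close> determines \<open>u\<close> recursively, and the boundary
  value problem can be solved by shooting, with the intermediate value theorem as the only
  topological input. To have a bounded nonlinearity, \<open>f(t, r)\<close> is first replaced by its value at
  \<open>r\<close> truncated to \<open>[-L, L]\<close>. Then \<open>u (b + 3)\<close> is a continuous function of \<open>\<beta>\<close> that differs from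
  \<open>\<beta> e(b + 2)\<close> by a bounded amount, and as \<open>e(b + 2) \<noteq> 0\<close> it vanishes for some \<open>\<beta>\<close>
  (\<open>shooting_seq_hits_zero\<close>). Eliminating \<open>\<beta>\<close> through \<open>u (b + 3) = 0\<close> gives the representation of \<open>u\<close> by
  the Green's function (\<open>shooting_seq_eq_green_sum\<close>). By the growth bound on \<open>f\<close>, every \<open>\<bar>u n\<bar>\<close> is
  then at most \<open>\<psi>(L)\<close> times the maximum of the sums of \<open>g(s) \<bar>G(t, s)\<bar>\<close>, which is less than \<open>L\<close>; so
  the truncation is inactive and \<open>u\<close> solves the original problem. If \<open>u\<close> vanished on the grid, the
  left-hand sides of the equations would all be \<open>0\<close>, and hence also \<open>f(\<cdot>, 0)\<close>.
\<close>

section \<open>Fractional differences as convolutions\<close>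

unbundle no vec_syntax
unbundle fps_syntax

text \<open>The binomial series of \<open>(1 - X)^(-\<nu>)\<close>.\<close>

definition binom_series :: "real \<Rightarrow> real fps" where
  "binom_series \<nu> = Abs_fps (\<lambda>n. pochhammer \<nu> n / fact n)"

lemma binom_series_nth: "binom_series \<nu> $ n = pochhammer \<nu> n / fact n"
  by (simp add: binom_series_def)

text \<open>The law of exponents is the Vandermonde identity for rising factorials.\<close>

lemma binom_series_mult: "binom_series a * binom_series b = binom_series (a + b)"
proof (rule fps_ext)
  fix n
  have "(binom_series a * binom_series b) $ n =
        (\<Sum>k\<le>n. real (n choose k) * pochhammer a k * pochhammer b (n - k) / fact n)"
    by (simp add: fps_mult_nth binom_series_nth atLeast0AtMost)
      (intro sum.cong refl, simp add: binomial_fact field_simps)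
  then show "(binom_series a * binom_series b) $ n = binom_series (a + b) $ n"
    by (simp add: binom_series_nth pochhammer_binomial_sum sum_divide_distrib)
qed

lemma binom_series_0: "binom_series 0 = 1"
  by (rule fps_ext) (simp add: binom_series_nth pochhammer_0_left)

lemma binom_series_minus_1: "binom_series (-1) = 1 - fps_X"
proof (rule fps_ext)
  fix n :: nat
  consider "n = 0" | "n = 1" | m where "n = Suc (Suc m)"
    by (metis One_nat_def not0_implies_Suc)
  then show "binom_series (-1) $ n = (1 - fps_X) $ n"
    by cases (simp_all add: binom_series_nth pochhammer_rec fps_X_def)
qed

definition grid_series :: "real \<Rightarrow> (real \<Rightarrow> real) \<Rightarrow> real fps" where
  "grid_series a f = Abs_fps (\<lambda>n. f (a + real n))"

lemma grid_series_nth: "grid_series a f $ n = f (a + real n)"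
  by (simp add: grid_series_def)

lemma dint_eq_image: "dint a (a + real n) = (\<lambda>k. a + real k) ` {..n}"
  by (auto simp: dint_def dset_def)

lemma sum_dint: "(\<Sum>s\<in>dint a (a + real n). h s) = (\<Sum>k\<le>n. h (a + real k))"
  unfolding dint_eq_image by (subst sum.reindex) (auto simp: inj_on_def)

text \<open>The kernel of the fractional sum, divided by \<open>Gamma \<nu>\<close>, is a quotient of Gamma values whose
  arguments differ from \<open>\<nu>\<close> and \<open>1\<close> by the same natural number \<open>n - k\<close>. It is thus a rising factorial
  over a factorial, that is, a binomial coefficient of \<open>(1 - X)^(-\<nu>)\<close>.\<close>

lemma frac_sum_eq_coeff:
  assumes "0 \<le> \<nu>"
  shows "frac_sum \<nu> a f (a + \<nu> + real n) = (binom_series \<nu> * grid_series a f) $ n"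
proof (cases "\<nu> = 0")
  case True
  then show ?thesis
    by (simp add: frac_sum_def binom_series_0 grid_series_nth)
next
  case False
  with assms have pos: "0 < \<nu>" by simp
  have kernel: "ffall (a + \<nu> + real n - (a + real k) - 1) (\<nu> - 1) = Gamma \<nu> * binom_series \<nu> $ (n - k)"
    if "k \<le> n" for k
  proof -
    have poch: "pochhammer \<nu> (n - k) = Gamma (\<nu> + real (n - k)) / Gamma \<nu>"
      using pos by (intro pochhammer_Gamma) (auto elim!: nonpos_Ints_cases)
    have fact: "Gamma (1 + real (n - k)) = fact (n - k)"
      by (simp add: Gamma_fact)
    have args: "a + \<nu> + real n - (a + real k) - 1 + 1 = \<nu> + real (n - k)"
      "\<nu> + real (n - k) - (\<nu> - 1) = 1 + real (n - k)"
      using that by (simp_all add: of_nat_diff)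
    show ?thesis
      unfolding ffall_def binom_series_nth args poch fact
      using Gamma_real_pos[OF pos] by simp
  qed
  have "frac_sum \<nu> a f (a + \<nu> + real n) =
        1 / Gamma \<nu> * (\<Sum>k\<le>n. ffall (a + \<nu> + real n - (a + real k) - 1) (\<nu> - 1) * f (a + real k))"
  proof -
    have "a + \<nu> + real n - \<nu> = a + real n" by simp
    then show ?thesis
      using False by (simp only: frac_sum_def sum_dint if_False)
  qed
  also have "\<dots> = (\<Sum>k\<le>n. f (a + real k) * binom_series \<nu> $ (n - k))"
    unfolding sum_distrib_left
  proof (rule sum.cong)
    fix k assume "k \<in> {..n}"
    then have "k \<le> n" by simp
    then show "1 / Gamma \<nu> * (ffall (a + \<nu> + real n - (a + real k) - 1) (\<nu> - 1) * f (a + real k))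
        = f (a + real k) * binom_series \<nu> $ (n - k)"
      unfolding kernel[OF \<open>k \<le> n\<close>] using Gamma_real_pos[OF pos] by simp
  qed simp
  also have "\<dots> = (grid_series a f * binom_series \<nu>) $ n"
    by (simp add: fps_mult_nth grid_series_nth atLeast0AtMost)
  finally show ?thesis by (simp add: mult.commute)
qed

text \<open>One forward difference is multiplication by \<open>1 - X\<close>, up to a shift of the coefficients by one.\<close>

lemma fdiff_funpow_eq_coeff:
  "(fdiff ^^ N) F (c + real n) = (binom_series (- real N) * grid_series c F) $ (n + N)"
proof (induction N arbitrary: n)
  case 0
  then show ?case by (simp add: binom_series_0 grid_series_nth)
next
  case (Suc N)
  have step: "binom_series (- real (Suc N)) = (1 - fps_X) * binom_series (- real N)"
    using binom_series_mult[of "-1" "- real N"] by (simp add: binom_series_minus_1)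
  have "(fdiff ^^ Suc N) F (c + real n) =
        (fdiff ^^ N) F (c + real (Suc n)) - (fdiff ^^ N) F (c + real n)"
    by (simp add: fdiff_def add_ac)
  then show ?case
    unfolding step Suc.IH by (simp add: left_diff_distrib mult.assoc)
qed

text \<open>By the law of exponents, \<open>N\<close> differences after a sum of order \<open>N - \<nu>\<close> multiply by
  \<open>(1 - X)^N (1 - X)^(\<nu> - N) = (1 - X)^\<nu>\<close>. The integer \<open>N\<close> is kept as a parameter so that the evaluation
  point and the index shift are visible.\<close>

lemma frac_diff_eq_coeff:
  fixes N :: nat
  assumes "real N - 1 < \<nu>" "\<nu> \<le> real N"
  shows "frac_diff \<nu> a f (a + (real N - \<nu>) + real n)
         = (binom_series (- \<nu>) * grid_series a f) $ (n + N)"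
proof -
  have N: "nat \<lceil>\<nu>\<rceil> = N"
    using ceiling_unique[of "int N" \<nu>] assms by simp
  have "grid_series (a + (real N - \<nu>)) (frac_sum (real N - \<nu>) a f)
        = binom_series (real N - \<nu>) * grid_series a f"
    using assms by (intro fps_ext) (simp add: grid_series_nth frac_sum_eq_coeff)
  moreover have "binom_series (- real N) * binom_series (real N - \<nu>) = binom_series (- \<nu>)"
    by (simp add: binom_series_mult)
  ultimately show ?thesis
    unfolding frac_diff_def Let_def N fdiff_funpow_eq_coeff by (simp flip: mult.assoc)
qed

section \<open>The Mittag-Leffler series\<close>

lemma summable_power_times_poly_growth:
  fixes l :: real
  assumes "\<bar>l\<bar> < 1"
  shows "summable (\<lambda>k. l ^ k * (real k + 1) ^ n)"
proof (cases "l = 0")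
  case True
  have "(\<lambda>k. l ^ k * (real k + 1) ^ n) = (\<lambda>k. if k = 0 then 1 else 0)"
    using True by (auto simp: power_0_left)
  then show ?thesis by simp
next
  case False
  have "(\<lambda>k. \<bar>l\<bar> * ((real k + 2) / (real k + 1)) ^ n) \<longlonglongrightarrow> \<bar>l\<bar> * 1 ^ n"
    by (intro tendsto_intros) real_asymp
  then have "\<forall>\<^sub>F k in sequentially. \<bar>l\<bar> * ((real k + 2) / (real k + 1)) ^ n < (1 + \<bar>l\<bar>) / 2"
    using assms by (intro order_tendstoD(2)) auto
  then obtain K where K: "\<And>k. K \<le> k \<Longrightarrow>
      \<bar>l\<bar> * ((real k + 2) / (real k + 1)) ^ n < (1 + \<bar>l\<bar>) / 2"
    by (auto simp: eventually_sequentially)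
  show ?thesis
  proof (rule summable_ratio_test)
    show "(1 + \<bar>l\<bar>) / 2 < 1" using assms by simp
    fix k assume "K \<le> k"
    have "norm (l ^ Suc k * (real (Suc k) + 1) ^ n) =
          (\<bar>l\<bar> * ((real k + 2) / (real k + 1)) ^ n) * norm (l ^ k * (real k + 1) ^ n)"
      by (simp add: abs_mult power_abs power_divide add_ac)
    also have "\<dots> \<le> (1 + \<bar>l\<bar>) / 2 * norm (l ^ k * (real k + 1) ^ n)"
      using K[OF \<open>K \<le> k\<close>] by (intro mult_right_mono) auto
    finally show "norm (l ^ Suc k * (real (Suc k) + 1) ^ n)
        \<le> (1 + \<bar>l\<bar>) / 2 * norm (l ^ k * (real k + 1) ^ n)" .
  qed
qed

text \<open>For fixed \<open>n\<close> the coefficient is a polynomial in \<open>k\<close> of degree at most \<open>n\<close>, so the geometric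
  decay of \<open>l ^ k\<close> dominates.\<close>

lemma summable_binom_series_coeff:
  fixes l :: real
  assumes "\<bar>l\<bar> < 1"
  shows "summable (\<lambda>k. l ^ k * binom_series (real k * p + q) $ n)"
proof (rule summable_comparison_test')
  let ?C = "\<bar>p\<bar> + \<bar>q\<bar> + real n"
  show "summable (\<lambda>k. ?C ^ n / fact n * (\<bar>l\<bar> ^ k * (real k + 1) ^ n))"
    using assms by (intro summable_mult summable_power_times_poly_growth) simp
  fix k :: nat
  have "\<bar>real k * p + q + real i\<bar> \<le> ?C * (real k + 1)" if "i < n" for i
  proof -
    have "\<bar>real k * p\<bar> = real k * \<bar>p\<bar>"
      by (simp add: abs_mult)
    then have "\<bar>real k * p + q + real i\<bar> \<le> real k * \<bar>p\<bar> + \<bar>q\<bar> + real i"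
      by linarith
    also have "\<dots> \<le> ?C * (real k + 1)"
    proof -
      have "real i \<le> real n" "0 \<le> \<bar>q\<bar> * real k" "0 \<le> real n * real k" "0 \<le> \<bar>p\<bar>"
        using that by simp_all
      moreover have "?C * (real k + 1) - (real k * \<bar>p\<bar> + \<bar>q\<bar> + real i)
          = \<bar>p\<bar> + \<bar>q\<bar> * real k + real n * real k + (real n - real i)"
        by (simp add: algebra_simps)
      ultimately show ?thesis by linarith
    qed
    finally show ?thesis .
  qed
  then have "\<bar>pochhammer (real k * p + q) n\<bar> \<le> (\<Prod>i<n. ?C * (real k + 1))"
    unfolding pochhammer_prod abs_prod atLeast0LessThan by (intro prod_mono) auto
  then have poch: "\<bar>pochhammer (real k * p + q) n\<bar> \<le> ?C ^ n * (real k + 1) ^ n"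
    by (simp add: power_mult_distrib)
  have "norm (l ^ k * binom_series (real k * p + q) $ n) =
      \<bar>l\<bar> ^ k / fact n * \<bar>pochhammer (real k * p + q) n\<bar>"
    by (simp add: binom_series_nth abs_mult power_abs)
  also have "\<dots> \<le> \<bar>l\<bar> ^ k / fact n * (?C ^ n * (real k + 1) ^ n)"
    using poch by (intro mult_left_mono) auto
  finally show "norm (l ^ k * binom_series (real k * p + q) $ n)
      \<le> ?C ^ n / fact n * (\<bar>l\<bar> ^ k * (real k + 1) ^ n)"
    by (simp add: mult_ac)
qed

text \<open>The factor \<open>fps_X\<close> shifts the index, so that the coefficient at \<open>n\<close> is the Mittag-Leffler value
  at \<open>n - 1\<close>. The value \<open>0\<close> at \<open>- 1\<close>, which occurs in the Green's function, is then the constant term.\<close>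

definition ml_series :: "real \<Rightarrow> real \<Rightarrow> real \<Rightarrow> real fps" where
  "ml_series p q l = fps_X * Abs_fps (\<lambda>n. \<Sum>k. l ^ k * binom_series (real k * p + q) $ n)"

lemma ml_series_0 [simp]: "ml_series p q l $ 0 = 0"
  by (simp add: ml_series_def)

lemma dml_eq_ml_series:
  assumes "0 \<le> p" "0 < q"
  shows "dml p q l (real n - 1) = ml_series p q l $ n"
proof (cases n)
  case 0
  then show ?thesis
    by (simp add: dml_def ffall_def)
next
  case (Suc m)
  have "ffall (real m + real k * p + q - 1) (real k * p + q - 1) / Gamma (real k * p + q)
        = binom_series (real k * p + q) $ m" for k
  proof -
    have pos: "0 < real k * p + q"
      using assms by (simp add: add_nonneg_pos)
    then have "pochhammer (real k * p + q) m = Gamma (real k * p + q + real m) / Gamma (real k * p + q)"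
      by (intro pochhammer_Gamma) (auto elim!: nonpos_Ints_cases)
    moreover have "Gamma (1 + real m) = fact m"
      by (simp add: Gamma_fact)
    ultimately show ?thesis
      by (simp add: ffall_def binom_series_nth add_ac)
  qed
  then show ?thesis
    by (simp add: Suc dml_def ml_series_def)
qed

text \<open>Multiplication by \<open>(1 - X)^q\<close> turns the exponent \<open>- (k p + q)\<close> of the \<open>k\<close>-th summand into
  \<open>- k p\<close>, and multiplication by \<open>l (1 - X)^(q - p)\<close> turns the summand \<open>l^k (1 - X)^(- (k p + q))\<close> into
  \<open>l^(k + 1) (1 - X)^(- (k + 1) p)\<close>. The difference telescopes to the term with \<open>k = 0\<close>, which is \<open>1\<close>.
  With \<open>q = \<upsilon>\<close> and \<open>p = \<upsilon> - \<mu>\<close> the first factor is the symbol of the difference operator.\<close>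

lemma symbol_times_ml_series:
  assumes "\<bar>l\<bar> < 1"
  shows "(binom_series (- q) - fps_const l * binom_series (p - q)) * ml_series p q l = fps_X"
proof -
  let ?E = "Abs_fps (\<lambda>n. \<Sum>k. l ^ k * binom_series (real k * p + q) $ n)"
  have conv: "(\<lambda>k. l ^ k * binom_series (real k * p + q + c) $ n) sums ((binom_series c * ?E) $ n)"
    for c n
  proof -
    have "(\<lambda>k. \<Sum>i=0..n. binom_series c $ i * (l ^ k * binom_series (real k * p + q) $ (n - i)))
          sums (\<Sum>i=0..n. binom_series c $ i * ?E $ (n - i))"
      using summable_binom_series_coeff[OF assms]
      by (intro sums_sum sums_mult) (simp add: summable_sums)
    moreover have "(\<Sum>i=0..n. binom_series c $ i * (l ^ k * binom_series (real k * p + q) $ (n - i)))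
          = l ^ k * binom_series (real k * p + q + c) $ n" for k
    proof -
      have "binom_series (real k * p + q + c) = binom_series c * binom_series (real k * p + q)"
        by (simp add: binom_series_mult add_ac)
      then show ?thesis
        by (simp add: fps_mult_nth sum_distrib_left mult_ac)
    qed
    ultimately show ?thesis by (simp add: fps_mult_nth)
  qed
  have "(binom_series (- q) - fps_const l * binom_series (p - q)) * ?E = 1"
  proof (rule fps_ext)
    fix n
    have a: "(\<lambda>k. l ^ k * binom_series (real k * p) $ n) sums ((binom_series (- q) * ?E) $ n)"
      using conv[of "- q" n] by simp
    have "(\<lambda>k. l * (l ^ k * binom_series (real k * p + q + (p - q)) $ n)) sums
          (l * (binom_series (p - q) * ?E) $ n)"
      by (intro sums_mult conv)
    then have "(\<lambda>k. l ^ Suc k * binom_series (real (Suc k) * p) $ n) sums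
          (l * (binom_series (p - q) * ?E) $ n)"
      by (simp add: algebra_simps)
    then have "(\<lambda>k. l ^ k * binom_series (real k * p) $ n) sums
          (l * (binom_series (p - q) * ?E) $ n + l ^ 0 * binom_series (real 0 * p) $ n)"
      by (subst (asm) sums_Suc_iff) simp
    from sums_unique2[OF a this]
    show "((binom_series (- q) - fps_const l * binom_series (p - q)) * ?E) $ n = (1 :: real fps) $ n"
      by (simp add: left_diff_distrib mult.assoc binom_series_0)
  qed
  then show ?thesis
    by (simp add: ml_series_def mult.left_commute)
qed

section \<open>Shooting for the discrete Volterra equation\<close>

text \<open>The sum stops at \<open>n - 2\<close> to make the recursion well-founded. In the application \<open>w 0 = 0\<close>, and
  then the convolution may be extended to \<open>m = n - 1\<close>.\<close>

function shooting_seq :: "(nat \<Rightarrow> real) \<Rightarrow> (nat \<Rightarrow> real \<Rightarrow> real) \<Rightarrow> real \<Rightarrow> nat \<Rightarrow> real" where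
  "shooting_seq w F \<beta> n = \<beta> * w n - (\<Sum>m\<in>{..<n - 1}. w (n - 1 - m) * F m (shooting_seq w F \<beta> (Suc m)))"
  by pat_completeness auto
termination by (relation "Wellfounded.measure (\<lambda>(w, F, \<beta>, n). n)") auto

declare shooting_seq.simps [simp del]

lemma shooting_seq_eq_full_sum:
  assumes "w 0 = 0"
  shows "shooting_seq w F \<beta> n = \<beta> * w n - (\<Sum>m<n. w (n - 1 - m) * F m (shooting_seq w F \<beta> (Suc m)))"
proof (cases n)
  case (Suc k)
  then show ?thesis
    using assms by (subst shooting_seq.simps) simp
qed (simp add: assms shooting_seq.simps[of _ _ _ 0])

lemma continuous_on_shooting_seq:
  assumes "\<And>m. m + 1 < n \<Longrightarrow> continuous_on UNIV (F m)"
  shows "continuous_on UNIV (\<lambda>\<beta>. shooting_seq w F \<beta> n)"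
  using assms
proof (induction n rule: less_induct)
  case (less n)
  have "continuous_on UNIV (\<lambda>\<beta>. F m (shooting_seq w F \<beta> (Suc m)))" if "m < n - 1" for m
  proof (rule continuous_on_compose2[of UNIV "F m"])
    show "continuous_on UNIV (\<lambda>\<beta>. shooting_seq w F \<beta> (Suc m))"
      using that less.prems by (intro less.IH) auto
  qed (use that less.prems in auto)
  then show ?case
    unfolding shooting_seq.simps[of w F _ n] by (intro continuous_intros) auto
qed

text \<open>The last value is \<open>\<beta> * w n\<close> up to a bounded continuous perturbation, so it takes both signs as
  \<open>\<beta>\<close> varies.\<close>

lemma shooting_seq_hits_zero:
  assumes "w n \<noteq> 0"
    and "\<And>m. m + 1 < n \<Longrightarrow> continuous_on UNIV (F m)"
    and "\<And>m r. m + 1 < n \<Longrightarrow> \<bar>F m r\<bar> \<le> C m"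
  obtains \<beta> where "shooting_seq w F \<beta> n = 0"
proof -
  define B where "B = (\<Sum>m<n - 1. \<bar>w (n - 1 - m)\<bar> * C m)"
  have near: "\<bar>shooting_seq w F \<beta> n - \<beta> * w n\<bar> \<le> B" for \<beta>
  proof -
    have "\<bar>shooting_seq w F \<beta> n - \<beta> * w n\<bar> = \<bar>\<Sum>m<n - 1. w (n - 1 - m) * F m (shooting_seq w F \<beta> (Suc m))\<bar>"
      by (subst shooting_seq.simps) simp
    also have "\<dots> \<le> B"
      unfolding B_def
      by (rule order_trans[OF sum_abs sum_mono]) (use assms(3) in \<open>auto simp: abs_mult intro!: mult_left_mono\<close>)
    finally show ?thesis .
  qed
  have "0 \<le> B" using near[of 0] by linarith
  \<comment> \<open>Using \<open>s = \<beta> * w n\<close> as the parameter avoids a case distinction on the sign of \<open>w n\<close>.\<close>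
  have "continuous_on {- B..B} (\<lambda>s. shooting_seq w F (s / w n) n)"
    using continuous_on_shooting_seq[of n F w] assms(1,2)
    by (intro continuous_on_compose2[of UNIV "\<lambda>\<beta>. shooting_seq w F \<beta> n" _ "\<lambda>s. s / w n"] continuous_intros)
      simp_all
  moreover have "shooting_seq w F (- B / w n) n \<le> 0" "0 \<le> shooting_seq w F (B / w n) n"
    using near[of "- B / w n"] near[of "B / w n"] assms(1) by auto
  ultimately obtain s where "shooting_seq w F (s / w n) n = 0"
    using IVT'[of "\<lambda>s. shooting_seq w F (s / w n) n" "- B" 0 B] \<open>0 \<le> B\<close> by auto
  then show thesis by (rule that)
qed

text \<open>The condition at \<open>N\<close> determines \<open>\<beta>\<close> as a linear functional of the right-hand sides. Substituting it
  into the recursion leaves a kernel that depends on \<open>w\<close> alone: the Green's function.\<close>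

lemma shooting_seq_eq_green_sum:
  assumes w0: "w 0 = 0" and wN: "w N \<noteq> 0" and hit: "shooting_seq w F \<beta> N = 0" and "n \<le> N"
  shows "shooting_seq w F \<beta> n = (\<Sum>m<N - 1.
    (w n / w N * w (N - 1 - m) - (if m < n then w (n - 1 - m) else 0)) * F m (shooting_seq w F \<beta> (Suc m)))"
proof -
  let ?h = "\<lambda>m. F m (shooting_seq w F \<beta> (Suc m))"
  have "\<beta> * w N = (\<Sum>m<N - 1. w (N - 1 - m) * ?h m)"
    using hit by (simp add: shooting_seq.simps[of w F \<beta> N])
  then have "\<beta> * w n = w n / w N * (\<Sum>m<N - 1. w (N - 1 - m) * ?h m)"
    using wN by (simp add: field_simps)
  then have "shooting_seq w F \<beta> n =
      (\<Sum>m<N - 1. w n / w N * w (N - 1 - m) * ?h m) - (\<Sum>m<n - 1. w (n - 1 - m) * ?h m)"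
    by (subst shooting_seq.simps) (simp only: sum_distrib_left mult.assoc)
  also have "(\<Sum>m<n - 1. w (n - 1 - m) * ?h m) =
      (\<Sum>m<N - 1. (if m < n then w (n - 1 - m) else 0) * ?h m)"
  proof (rule sum.mono_neutral_cong_left)
    show "\<forall>m\<in>{..<N - 1} - {..<n - 1}. (if m < n then w (n - 1 - m) else 0) * ?h m = 0"
      using w0 by auto
  qed (use \<open>n \<le> N\<close> in auto)
  finally show ?thesis
    by (simp add: sum_subtractf left_diff_distrib)
qed

text \<open>With \<open>U\<close> and \<open>H\<close> the series of the shooting sequence and of its right-hand sides, the recursion
  reads \<open>U = \<beta> W - X H W\<close>. Multiplying by \<open>D\<close> gives \<open>D U = \<beta> X - X\<^sup>2 H\<close>.\<close>

lemma symbol_times_shooting_seq: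
  assumes w0: "W $ 0 = 0" and DW: "D * W = (fps_X :: real fps)"
  shows "(D * Abs_fps (shooting_seq (fps_nth W) F \<beta>)) $ (m + 2) = - F m (shooting_seq (fps_nth W) F \<beta> (Suc m))"
proof -
  let ?u = "shooting_seq (fps_nth W) F \<beta>"
  define H where "H = Abs_fps (\<lambda>m. F m (?u (Suc m)))"
  have "Abs_fps ?u = fps_const \<beta> * W - fps_X * (H * W)"
  proof (rule fps_ext)
    fix n
    show "Abs_fps ?u $ n = (fps_const \<beta> * W - fps_X * (H * W)) $ n"
    proof (cases n)
      case (Suc k)
      have "(fps_X * (H * W)) $ n = (H * W) $ k"
        by (simp add: Suc)
      also have "\<dots> = (\<Sum>m<n. W $ (n - 1 - m) * F m (?u (Suc m)))"
        by (simp add: Suc fps_mult_nth H_def atLeast0AtMost lessThan_Suc_atMost)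
          (simp add: mult.commute)
      finally have "(fps_X * (H * W)) $ n = (\<Sum>m<n. W $ (n - 1 - m) * F m (?u (Suc m)))" .
      then show ?thesis
        using shooting_seq_eq_full_sum[of "fps_nth W" F \<beta> n] w0 by simp
    qed (simp add: w0 shooting_seq.simps[of _ _ _ 0])
  qed
  then have "D * Abs_fps ?u = fps_const \<beta> * (D * W) - fps_X * (H * (D * W))"
    by (simp only: right_diff_distrib mult.left_commute[of D])
  also have "\<dots> = fps_const \<beta> * fps_X - fps_X * (fps_X * H)"
    by (simp add: DW mult_ac)
  finally show ?thesis
    by (simp add: H_def)
qed

section \<open>The boundary value problem\<close>

text \<open>The lower-order difference acts on \<open>y\<close> shifted by one grid point. The condition \<open>y (\<upsilon> - 2) = 0\<close> says
  that this shift is division of the series by \<open>X\<close>, so that both terms are read off at \<open>m + 2\<close>.\<close>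

lemma bvp_operator_eq_coeff:
  assumes "1 < \<upsilon>" "\<upsilon> < 2" "0 < \<mu>" "\<mu> < 1" "y (\<upsilon> - 2) = 0"
  shows "- frac_diff \<upsilon> (\<upsilon> - 2) y (real m) + \<alpha> * frac_diff \<mu> (\<mu> - 1) (\<lambda>x. y (x + \<upsilon> - \<mu>)) (real m)
    = - ((binom_series (- \<upsilon>) - fps_const \<alpha> * binom_series (- \<mu>)) * grid_series (\<upsilon> - 2) y) $ (m + 2)"
proof -
  let ?V = "grid_series (\<mu> - 1) (\<lambda>x. y (x + \<upsilon> - \<mu>))"
  have shift: "grid_series (\<upsilon> - 2) y = fps_X * ?V"
  proof (rule fps_ext)
    fix n
    show "grid_series (\<upsilon> - 2) y $ n = (fps_X * ?V) $ n"
      using assms(5) by (cases n) (simp_all add: grid_series_nth algebra_simps)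
  qed
  have "frac_diff \<upsilon> (\<upsilon> - 2) y (real m) = (binom_series (- \<upsilon>) * grid_series (\<upsilon> - 2) y) $ (m + 2)"
    using frac_diff_eq_coeff[of 2 \<upsilon> "\<upsilon> - 2" y m] assms by simp
  moreover have "frac_diff \<mu> (\<mu> - 1) (\<lambda>x. y (x + \<upsilon> - \<mu>)) (real m) = (binom_series (- \<mu>) * ?V) $ (m + 1)"
    using frac_diff_eq_coeff[of 1 \<mu> "\<mu> - 1" "\<lambda>x. y (x + \<upsilon> - \<mu>)" m] assms by simp
  moreover have "(binom_series (- \<mu>) * grid_series (\<upsilon> - 2) y) $ (m + 2) = (binom_series (- \<mu>) * ?V) $ (m + 1)"
    unfolding shift by (simp add: mult.left_commute)
  ultimately show ?thesis
    by (simp add: left_diff_distrib mult.assoc)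
qed

theorem theorem13:
  fixes \<upsilon> \<mu> \<alpha> L :: real and b :: nat
    and f :: "real \<Rightarrow> real \<Rightarrow> real" and \<psi> g :: "real \<Rightarrow> real"
  assumes "1 < \<upsilon>" "\<upsilon> < 2" "0 < \<mu>" "\<mu> < 1" "1 \<le> b" "\<bar>\<alpha>\<bar> < 1"
    and "dml (\<upsilon> - \<mu>) \<upsilon> \<alpha> (real b + 2) \<noteq> 0"
    and "continuous_on (dint (\<upsilon> - 1) (\<upsilon> + real b) \<times> UNIV) (\<lambda>(t, r). f t r)"
    and "mono_on {0..} \<psi>" "\<And>r. 0 \<le> r \<Longrightarrow> 0 \<le> \<psi> r"
    and "\<And>t. t \<in> dint (\<upsilon> - 2) (\<upsilon> + real b + 1) \<Longrightarrow> 0 \<le> g t"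
    and "\<And>t r. t \<in> dint 0 (real b + 1) \<Longrightarrow>
           \<bar>f (t + \<upsilon> - 1) r\<bar> \<le> g (t + \<upsilon> - 1) * \<psi> \<bar>r\<bar>"
    and "0 < L"
    and "L / (\<psi> L * (MAX t\<in>dint (\<upsilon> - 2) (\<upsilon> + real b + 1).
           \<Sum>s\<in>dint (\<upsilon> - 1) (\<upsilon> + real b). g s * \<bar>green \<upsilon> \<mu> \<alpha> b t s\<bar>)) > 1"
  shows "\<exists>y. bvp_solution \<upsilon> \<mu> \<alpha> b f y \<and>
           ((\<exists>t\<in>dint 0 (real b + 1). f (t + \<upsilon> - 1) 0 \<noteq> 0) \<longrightarrow>
            (\<exists>t\<in>dint (\<upsilon> - 2) (\<upsilon> + real b + 1). y t \<noteq> 0))"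
proof -
  define W where "W = ml_series (\<upsilon> - \<mu>) \<upsilon> \<alpha>"
  define w where "w = fps_nth W"
  define D where "D = binom_series (- \<upsilon>) - fps_const \<alpha> * binom_series (- \<mu>)"
  define clamp where "clamp r = max (- L) (min L r)" for r :: real
  define F where "F m r = f (real m + \<upsilon> - 1) (clamp r)" for m r
  have grid_f: "dint 0 (real b + 1) = real ` {..b + 1}"
    using dint_eq_image[of 0 "b + 1"] by (simp add: add.commute)
  have grid_s: "dint (\<upsilon> - 1) (\<upsilon> + real b) = dint (\<upsilon> - 1) (\<upsilon> - 1 + real (b + 1))"
    by (simp add: algebra_simps)
  have grid_y: "dint (\<upsilon> - 2) (\<upsilon> + real b + 1) = (\<lambda>k. \<upsilon> - 2 + real k) ` {..b + 3}"
    using dint_eq_image[of "\<upsilon> - 2" "b + 3"] by (simp add: algebra_simps)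
  have W0: "W $ 0 = 0" and w0: "w 0 = 0"
    by (simp_all add: w_def W_def)
  have DW: "D * W = fps_X"
    using symbol_times_ml_series[OF \<open>\<bar>\<alpha>\<bar> < 1\<close>, of \<upsilon> "\<upsilon> - \<mu>"] by (simp add: D_def W_def)
  have dml_w: "dml (\<upsilon> - \<mu>) \<upsilon> \<alpha> (real n - 1) = w n" for n
    using assms(1-4) by (simp add: w_def W_def dml_eq_ml_series)
  have wN: "w (b + 3) \<noteq> 0"
    using assms(7) dml_w[of "b + 3"] by (simp add: algebra_simps)
  have green_w: "green \<upsilon> \<mu> \<alpha> b (\<upsilon> - 2 + real n) (\<upsilon> - 1 + real m)
      = w n / w (b + 3) * w (b + 2 - m) - (if m < n then w (n - 1 - m) else 0)"
    if "m \<le> b + 1" for n m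
  proof -
    have "\<upsilon> - 2 + real n - \<upsilon> + 1 = real n - 1" "real b + 2 = real (b + 3) - 1"
      "\<upsilon> + real b - (\<upsilon> - 1 + real m) = real (b + 2 - m) - 1"
      using that by (simp_all add: of_nat_diff)
    moreover have "\<upsilon> - 2 + real n - (\<upsilon> - 1 + real m) - 1 = real (n - 1 - m) - 1" if "m < n"
      using that by (simp add: of_nat_diff)
    moreover have "\<upsilon> - 1 + real m \<le> \<upsilon> - 2 + real n \<longleftrightarrow> m < n"
      by linarith
    ultimately show ?thesis
      unfolding green_def Let_def using dml_w by (simp only: if_distrib cong: if_cong) simp
  qed
  have clamp_bound: "\<bar>clamp r\<bar> \<le> L" for r
    using \<open>0 < L\<close> by (auto simp: clamp_def)
  have g_nonneg: "0 \<le> g (\<upsilon> - 1 + real m)" if "m \<le> b + 1" for m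
  proof -
    have "\<upsilon> - 1 + real m = \<upsilon> - 2 + real (Suc m)" by simp
    then show ?thesis
      using that assms(11) unfolding grid_y by (metis Suc_le_mono add_Suc_right atMost_iff imageI le_SucI
          numeral_3_eq_3 One_nat_def)
  qed
  have F_bound: "\<bar>F m r\<bar> \<le> g (\<upsilon> - 1 + real m) * \<psi> L" if "m \<le> b + 1" for m r
  proof -
    have "\<bar>F m r\<bar> \<le> g (real m + \<upsilon> - 1) * \<psi> \<bar>clamp r\<bar>"
      unfolding F_def using that by (intro assms(12)) (auto simp: grid_f)
    also have "\<dots> \<le> g (real m + \<upsilon> - 1) * \<psi> L"
      using clamp_bound[of r] \<open>0 < L\<close> g_nonneg[OF that]
      by (intro mult_left_mono mono_onD[OF assms(9)]) (auto simp: algebra_simps)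
    finally show ?thesis by (simp add: algebra_simps)
  qed
  have F_cont: "continuous_on UNIV (F m)" if "m \<le> b + 1" for m
  proof -
    have "real m + \<upsilon> - 1 \<in> dint (\<upsilon> - 1) (\<upsilon> + real b)"
      using that unfolding grid_s dint_eq_image by (auto intro!: image_eqI[of _ _ m])
    then have "continuous_on UNIV (\<lambda>r. case (real m + \<upsilon> - 1, clamp r) of (t, r) \<Rightarrow> f t r)"
      by (intro continuous_on_compose2[OF assms(8)])
        (auto simp: clamp_def intro!: continuous_intros)
    then show ?thesis by (simp add: F_def[abs_def])
  qed
  obtain \<beta> where hit: "shooting_seq w F \<beta> (b + 3) = 0"
    by (rule shooting_seq_hits_zero[of w "b + 3" F "\<lambda>m. g (\<upsilon> - 1 + real m) * \<psi> L"])
      (use wN F_cont F_bound in auto)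
  define u where "u = shooting_seq w F \<beta>"
  let ?M = "MAX t\<in>dint (\<upsilon> - 2) (\<upsilon> + real b + 1).
           \<Sum>s\<in>dint (\<upsilon> - 1) (\<upsilon> + real b). g s * \<bar>green \<upsilon> \<mu> \<alpha> b t s\<bar>"
  have small: "\<psi> L * ?M < L"
  proof -
    have "0 < \<psi> L * ?M"
      using assms(13,14) by (smt (verit) divide_nonneg_nonpos)
    then show ?thesis
      using assms(14) by (simp add: less_divide_eq)
  qed
  \<comment> \<open>The a priori bound, which makes the truncation inactive.\<close>
  have u_small: "\<bar>u n\<bar> \<le> L" if "n \<le> b + 3" for n
  proof -
    let ?G = "\<lambda>m. green \<upsilon> \<mu> \<alpha> b (\<upsilon> - 2 + real n) (\<upsilon> - 1 + real m)"
    have "u n = (\<Sum>m\<le>b + 1. ?G m * F m (u (Suc m)))"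
      unfolding u_def shooting_seq_eq_green_sum[OF w0 wN hit that]
      by (rule sum.cong) (auto simp: green_w)
    then have "\<bar>u n\<bar> = \<bar>\<Sum>m\<le>b + 1. ?G m * F m (u (Suc m))\<bar>"
      by simp
    also have "\<dots> \<le> (\<Sum>m\<le>b + 1. \<psi> L * (g (\<upsilon> - 1 + real m) * \<bar>?G m\<bar>))"
    proof (rule order_trans[OF sum_abs sum_mono])
      fix m assume "m \<in> {..b + 1}"
      then have "\<bar>?G m\<bar> * \<bar>F m (u (Suc m))\<bar> \<le> \<bar>?G m\<bar> * (g (\<upsilon> - 1 + real m) * \<psi> L)"
        by (intro mult_left_mono F_bound) auto
      then show "\<bar>?G m * F m (u (Suc m))\<bar> \<le> \<psi> L * (g (\<upsilon> - 1 + real m) * \<bar>?G m\<bar>)"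
        by (simp add: abs_mult mult_ac)
    qed
    also have "\<dots> = \<psi> L * (\<Sum>s\<in>dint (\<upsilon> - 1) (\<upsilon> + real b). g s * \<bar>green \<upsilon> \<mu> \<alpha> b (\<upsilon> - 2 + real n) s\<bar>)"
      unfolding grid_s sum_dint by (simp only: sum_distrib_left)
    also have "\<dots> \<le> \<psi> L * ?M"
      using that assms(10)[of L] \<open>0 < L\<close> unfolding grid_y
      by (intro mult_left_mono Max_ge) auto
    finally show ?thesis using small by simp
  qed
  define y where "y x = u (nat \<lfloor>x - (\<upsilon> - 2)\<rfloor>)" for x
  have y_grid: "y (\<upsilon> - 2 + real n) = u n" for n
    by (simp add: y_def)
  have y_f: "y (real m + \<upsilon> - 1) = u (Suc m)" for m
    using y_grid[of "Suc m"] by (simp add: algebra_simps)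
  have y0: "y (\<upsilon> - 2) = 0"
    using y_grid[of 0] by (simp add: u_def shooting_seq.simps[of _ _ _ 0] w0)
  have yN: "y (\<upsilon> + real b + 1) = 0"
    using y_grid[of "b + 3"] hit by (simp add: u_def algebra_simps)
  have series_y: "grid_series (\<upsilon> - 2) y = Abs_fps u"
    by (simp add: grid_series_def y_grid)
  let ?A = "\<lambda>m. - frac_diff \<upsilon> (\<upsilon> - 2) y (real m)
      + \<alpha> * frac_diff \<mu> (\<mu> - 1) (\<lambda>x. y (x + \<upsilon> - \<mu>)) (real m)"
  have A: "?A m = - (D * Abs_fps u) $ (m + 2)" for m
    using bvp_operator_eq_coeff[of \<upsilon> \<mu> y m \<alpha>, OF assms(1-4) y0] by (simp add: D_def series_y)
  have eqn: "?A m = f (real m + \<upsilon> - 1) (y (real m + \<upsilon> - 1))" if "m \<le> b + 1" for m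
  proof -
    have "clamp (u (Suc m)) = u (Suc m)"
      using u_small[of "Suc m"] that by (auto simp: clamp_def)
    then have "F m (u (Suc m)) = f (real m + \<upsilon> - 1) (y (real m + \<upsilon> - 1))"
      by (simp add: F_def y_f)
    then show ?thesis
      using symbol_times_shooting_seq[OF W0 DW, of F \<beta> m] unfolding A by (simp add: u_def w_def)
  qed
  have "bvp_solution \<upsilon> \<mu> \<alpha> b f y"
    unfolding bvp_solution_def grid_f using eqn y0 yN by auto
  moreover have "\<exists>t\<in>dint (\<upsilon> - 2) (\<upsilon> + real b + 1). y t \<noteq> 0"
    if nz: "\<exists>t\<in>dint 0 (real b + 1). f (t + \<upsilon> - 1) 0 \<noteq> 0"
  proof (rule ccontr)
    assume "\<not> ?thesis"
    then have u0: "u n = 0" if "n \<le> b + 3" for n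
      using that y_grid[of n] unfolding grid_y by auto
    obtain m where m: "m \<le> b + 1" "f (real m + \<upsilon> - 1) 0 \<noteq> 0"
      using nz unfolding grid_f by auto
    have "(D * Abs_fps u) $ (m + 2) = 0"
      using m(1) u0 by (simp add: fps_mult_nth)
    then have "?A m = 0"
      unfolding A by simp
    moreover have "y (real m + \<upsilon> - 1) = 0"
      using u0[of "Suc m"] m(1) by (simp add: y_f)
    ultimately show False
      using eqn[OF m(1)] m(2) by metis
  qed
  ultimately show ?thesis by blast
qed

end
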